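(* Let $d\ge1$, $R\ge 1$, let $D\subset\mathbb Z^d$ be an $R$-Delone set, and let $H_\omega=-\Delta+V_\omega$ be the associated Anderson model with missing sites with single-site distribution $\mu$, $\operatorname{supp}\mu\subset[0,M]$. For every $p>0$ there exist a constant $C>0$, depending only on $p,d,M$ and $\mu$, and a scale $\tilde L=\tilde L(d,\mu,p,R)$ such that for all $L\ge\tilde L$, $$\inf_{x\in\mathbb Z^d}\mathbb P\left(H_{\omega,x,L}\ge C R^{-2(d+2)}(\log L)^{-2/d}\right)\ge 1-L^{-pd}.$$
   Context: **Delone sets.** For a constant $R\ge 1$, a subset $D\subset\mathbb Z^d$ is an $R$-Delone set in $\mathbb Z^d$ if every closed cube in $\mathbb Z^d$ of side length $R$ in the max-norm, i.e. every set $(a+[0,R]^d)\cap\mathbb Z^d$ with $a\in\mathbb Z^d$, contains at least one point of $D$. No periodicity is assumed. **The model.** $(-\Delta u)(n)=-\sum_{|m-n|_1=1}(u(m)-u(n))$ on $\ell^2(\mathbb Z^d)$, where $|n|_1=\sum_i|n_i|$. The random potential is $V_\omega(n)=\omega(n)$ if $n\in D$ and $V_\omega(n)=0$ otherwise, acting as a multiplication operator, where $(\omega(n))_{n\in D}$ are i.i.d. real random variables with common distribution $\mu$, $\operatorname{supp}\mu\subset[0,M]$, $M>0$, on the product space $\Omega=[0,M]^D$ with probability $\mathbb P$. The distribution $\mu$ is regular, meaning absolutely continuous with bounded density. **Finite volume.** For $L\in\mathbb N$, $\Lambda_L(x)=\{n\in\mathbb Z^d:|n-x|_\infty\le L\}$,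 and $H_{\omega,x,L}$ is the restriction $\chi_{\Lambda_L(x)}H_\omega\chi_{\Lambda_L(x)}$ of $H_\omega$ to $\ell^2(\Lambda_L(x))$. The inequality $H_{\omega,x,L}\ge c$ is meant in the sense of quadratic forms on $\ell^2(\Lambda_L(x))$. *)

theory Defs
  imports "HOL-Probability.Probability"
begin

text \<open>The lattice $\mathbb{Z}^d$ is the type \<^typ>\<open>int ^ 'd\<close>, with dimension $d$ = \<open>CARD('d)\<close>.\<close>

definition l1_norm :: "int ^ 'd \<Rightarrow> int" where
  "l1_norm n = (\<Sum>i\<in>UNIV. \<bar>n $ i\<bar>)"

definition max_norm :: "int ^ 'd \<Rightarrow> int" where
  "max_norm n = (MAX i\<in>UNIV. \<bar>n $ i\<bar>)"

definition lattice_cube :: "real \<Rightarrow> int ^ 'd \<Rightarrow> (int ^ 'd) set" where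
  "lattice_cube R a = {n. \<forall>i. real_of_int (n $ i) \<in> {real_of_int (a $ i) .. real_of_int (a $ i) + R}}"

definition delone :: "real \<Rightarrow> (int ^ 'd) set \<Rightarrow> bool" where
  "delone R D \<longleftrightarrow> (\<forall>a. lattice_cube R a \<inter> D \<noteq> {})"

text \<open>$\ell^2(A)$ for a subset $A$ of the index set, its elements being extended by zero outside $A$.\<close>

definition ell2 :: "'a set \<Rightarrow> ('a \<Rightarrow> complex) set" where
  "ell2 A = {u. (\<forall>n. n \<notin> A \<longrightarrow> u n = 0) \<and> (\<lambda>n. (cmod (u n))\<^sup>2) summable_on A}"

definition ell2_inner :: "'a set \<Rightarrow> ('a \<Rightarrow> complex) \<Rightarrow> ('a \<Rightarrow> complex) \<Rightarrow> complex" where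
  "ell2_inner A u v = (\<Sum>\<^sub>\<infinity>n\<in>A. cnj (u n) * v n)"

text \<open>Operators are defined on all functions on the lattice; on \<^term>\<open>ell2 UNIV\<close> they are the
  operators of the model. The sum in the Laplacian has $2d$ terms.\<close>

definition neg_laplacian :: "(int ^ 'd \<Rightarrow> complex) \<Rightarrow> int ^ 'd \<Rightarrow> complex" where
  "neg_laplacian u n = - (\<Sum>m | l1_norm (m - n) = 1. u m - u n)"

definition potential :: "(int ^ 'd) set \<Rightarrow> (int ^ 'd \<Rightarrow> real) \<Rightarrow> int ^ 'd \<Rightarrow> real" where
  "potential D \<omega> n = (if n \<in> D then \<omega> n else 0)"

definition anderson_op ::
    "(int ^ 'd) set \<Rightarrow> (int ^ 'd \<Rightarrow> real) \<Rightarrow> (int ^ 'd \<Rightarrow> complex) \<Rightarrow> int ^ 'd \<Rightarrow> complex" where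
  "anderson_op D \<omega> u n = neg_laplacian u n + of_real (potential D \<omega> n) * u n"

definition lattice_box :: "int ^ 'd \<Rightarrow> nat \<Rightarrow> (int ^ 'd) set" where
  "lattice_box x L = {n. max_norm (n - x) \<le> int L}"

text \<open>The restriction $\chi_A T \chi_A$.\<close>

definition restrict_op ::
    "'a set \<Rightarrow> (('a \<Rightarrow> complex) \<Rightarrow> 'a \<Rightarrow> complex) \<Rightarrow> ('a \<Rightarrow> complex) \<Rightarrow> 'a \<Rightarrow> complex" where
  "restrict_op A T u n = indicator A n * T (\<lambda>m. indicator A m * u m) n"

definition anderson_box ::
    "(int ^ 'd) set \<Rightarrow> (int ^ 'd \<Rightarrow> real) \<Rightarrow> int ^ 'd \<Rightarrow> nat \<Rightarrow> (int ^ 'd \<Rightarrow> complex) \<Rightarrow> int ^ 'd \<Rightarrow> complex" where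
  "anderson_box D \<omega> x L = restrict_op (lattice_box x L) (anderson_op D \<omega>)"

text \<open>$T \ge c$ in the sense of quadratic forms on $\ell^2(A)$. It is used for symmetric $T$ only,
  whose form is real-valued, so that taking real parts loses nothing.\<close>

definition form_ge :: "'a set \<Rightarrow> (('a \<Rightarrow> complex) \<Rightarrow> 'a \<Rightarrow> complex) \<Rightarrow> real \<Rightarrow> bool" where
  "form_ge A T c \<longleftrightarrow> (\<forall>u\<in>ell2 A. Re (ell2_inner A u (T u)) \<ge> c * Re (ell2_inner A u u))"

definition msupport :: "real measure \<Rightarrow> real set" where
  "msupport \<mu> = {x. \<forall>U. open U \<and> x \<in> U \<longrightarrow> emeasure \<mu> U > 0}"

definition regular_distribution :: "real measure \<Rightarrow> bool" where
  "regular_distribution \<mu> \<longleftrightarrow> real_distribution \<mu> \<and>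
     (\<exists>f B. f \<in> borel_measurable borel \<and> (\<forall>x. 0 \<le> f x \<and> f x \<le> B) \<and>
            \<mu> = density lborel (\<lambda>x. ennreal (f x)))"

text \<open>The law of the couplings on $\Omega = [0,M]^D$; its elements are functions that are
  \<^const>\<open>undefined\<close> outside $D$. It is a probability measure if \<^term>\<open>\<mu>\<close> is one with
  support in $[0,M]$.\<close>

definition coupling_law :: "real measure \<Rightarrow> real \<Rightarrow> (int ^ 'd) set \<Rightarrow> (int ^ 'd \<Rightarrow> real) measure" where
  "coupling_law \<mu> M D = (\<Pi>\<^sub>M n\<in>D. restrict_space \<mu> {0..M})"

end

theory Submission imports Defs begin

text \<open>
  The kinetic energy controls translations: a walk from $0$ to $k$ with unit steps gives
  $\|u - u(\cdot + k)\|^2 \le 2 |k|_1^2 \langle u, -\Delta u\rangle$. Hence, if for every $n$ in the box a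
  fixed fraction of the sites $n + k$, $k \in K = [0, mr)^d$, carry a coupling of at least $\varepsilon$,
  averaging $|u(n)|^2 \le 2 |u(n) - u(n+k)|^2 + 2 |u(n+k)|^2$ over these $k$ bounds $\|u\|^2$ by a
  multiple of $(mr)^2 \langle u, H_\omega u\rangle$; no decomposition of the box into cubes is needed.
  With $r = \lfloor R\rfloor + 1$, the cube $n + K$ splits into $m^d$ disjoint cubes that each contain a point
  of $D$. If $\mu([0,\varepsilon])$ is small, the probability that at least half of these $m^d$ couplings are
  below $\varepsilon$ is at most $e^{-m^d}$ by a union bound over the subsets of the points. Taking
  $m^d \approx (p+2) d \log L$ leaves room for a further union bound over the sites $n$ of the box.
\<close>

section \<open>Lattice boxes and the l1 norm\<close>

lemma
  fixes a :: "int ^ 'd"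
  shows finite_vec_box: "finite {v. \<forall>i. a $ i \<le> v $ i \<and> v $ i < a $ i + int m}" (is "finite ?B")
    and card_vec_box: "card {v. \<forall>i. a $ i \<le> v $ i \<and> v $ i < a $ i + int m} = m ^ CARD('d)"
proof -
  let ?P = "PiE (UNIV :: 'd set) (\<lambda>i. {a $ i ..< a $ i + int m})"
  have bij: "bij_betw vec_nth ?B ?P"
    by (rule bij_betw_byWitness[where f' = vec_lambda]) (auto simp: PiE_iff)
  have "finite ?P" by (intro finite_PiE) auto
  then show "finite ?B" using bij bij_betw_finite by blast
  show "card ?B = m ^ CARD('d)"
    using bij_betw_same_card[OF bij] by (simp add: card_PiE)
qed

lemma l1_norm_nonneg: "0 \<le> l1_norm k"
  unfolding l1_norm_def by (simp add: sum_nonneg)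

lemma l1_norm_eq_0_iff: "l1_norm k = 0 \<longleftrightarrow> k = 0"
  unfolding l1_norm_def by (simp add: sum_nonneg_eq_0_iff vec_eq_iff)

lemma abs_component_le_l1_norm: "\<bar>k $ i\<bar> \<le> l1_norm k"
  unfolding l1_norm_def by (rule member_le_sum) auto

lemma finite_l1_sphere: "finite {k :: int ^ 'd. l1_norm k = int j}"
proof (rule finite_subset)
  let ?a = "\<chi> i. - int j :: int ^ 'd"
  show "{k. l1_norm k = int j} \<subseteq> {v. \<forall>i. ?a $ i \<le> v $ i \<and> v $ i < ?a $ i + int (2 * j + 1)}"
  proof (intro subsetI CollectI allI)
    fix k :: "int ^ 'd" and i assume "k \<in> {k. l1_norm k = int j}"
    then show "?a $ i \<le> k $ i \<and> k $ i < ?a $ i + int (2 * j + 1)"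
      using abs_component_le_l1_norm[of k i] by (simp add: abs_le_iff)
  qed
qed (rule finite_vec_box)

text \<open>Any nonzero coordinate can be moved one unit towards 0, by the axis vector carrying its
  sign. Iterating this gives a shortest walk from 0 to \<open>v\<close>.\<close>

lemma l1_norm_step:
  fixes v :: "int ^ 'd"
  assumes "l1_norm v = int (Suc j)"
  obtains k where "l1_norm k = 1" "l1_norm (v - k) = int j"
proof -
  have "v \<noteq> 0" using assms l1_norm_eq_0_iff[of v] by auto
  then obtain i where i: "v $ i \<noteq> 0" by (auto simp: vec_eq_iff)
  define k where "k = (axis i (sgn (v $ i)) :: int ^ 'd)"
  \<comment> \<open>The norm is separated at coordinate \<open>i\<close>, the only one in which
    \<open>v\<close> and \<open>v - k\<close> differ.\<close>
  have split: "l1_norm w = \<bar>w $ i\<bar> + (\<Sum>j\<in>UNIV - {i}. \<bar>w $ j\<bar>)" for w :: "int ^ 'd"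
    unfolding l1_norm_def by (simp add: sum.remove)
  have "l1_norm k = 1"
    using i by (simp add: split k_def axis_def sgn_if)
  moreover have "l1_norm (v - k) = l1_norm v - 1"
    using i by (simp add: split k_def axis_def sgn_if)
  ultimately show ?thesis using assms by (intro that) auto
qed

section \<open>Sums of finitely supported functions and their translates\<close>

lemma summable_on_finite_support:
  assumes "finite {n. u n \<noteq> 0}" "\<And>n. u n = 0 \<Longrightarrow> f n = 0"
  shows "f summable_on UNIV"
proof (rule finite_nonzero_values_imp_summable_on, rule finite_subset)
  show "{n \<in> UNIV. f n \<noteq> 0} \<subseteq> {n. u n \<noteq> 0}" using assms(2) by auto
qed (use assms(1) in auto)

lemma
  fixes f :: "'i \<Rightarrow> 'a \<Rightarrow> 'b :: {topological_comm_monoid_add, t2_space}"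
  assumes "\<And>i. i \<in> I \<Longrightarrow> f i summable_on A"
  shows summable_on_sum: "(\<lambda>x. \<Sum>i\<in>I. f i x) summable_on A"
    and infsum_sum: "(\<Sum>\<^sub>\<infinity>x\<in>A. \<Sum>i\<in>I. f i x) = (\<Sum>i\<in>I. infsum (f i) A)"
proof -
  have "((\<lambda>x. \<Sum>i\<in>I. f i x) has_sum (\<Sum>i\<in>I. infsum (f i) A)) A"
    using assms
    by (induction I rule: infinite_finite_induct) (auto intro!: has_sum_add)
  then show "(\<lambda>x. \<Sum>i\<in>I. f i x) summable_on A"
    "(\<Sum>\<^sub>\<infinity>x\<in>A. \<Sum>i\<in>I. f i x) = (\<Sum>i\<in>I. infsum (f i) A)"
    by (auto simp: has_sum_iff)
qed

lemma finite_support_shift: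
  fixes u :: "'a :: ab_group_add \<Rightarrow> 'b :: zero"
  assumes "finite {n. u n \<noteq> 0}"
  shows "finite {n. u (n + k) \<noteq> 0}"
proof -
  have "{n. u (n + k) \<noteq> 0} = (\<lambda>n. n - k) ` {n. u n \<noteq> 0}" by force
  then show ?thesis using assms by simp
qed

lemma infsum_shift:
  fixes f :: "'a :: ab_group_add \<Rightarrow> 'b :: {comm_monoid_add, t2_space}"
  shows "(\<Sum>\<^sub>\<infinity>n. f (n + k)) = (\<Sum>\<^sub>\<infinity>n. f n)"
  by (rule infsum_reindex_bij_betw) (rule bij_plus_right)

text \<open>Serves terms built from increments \<open>u n - u (n + k)\<close>, whose support lies in
  the union of the support of \<open>u\<close> and its translate.\<close>

lemma summable_on_finite_support2:
  fixes u :: "'a :: ab_group_add \<Rightarrow> 'b :: zero"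
  assumes "finite {n. u n \<noteq> 0}" "\<And>n. u n = 0 \<Longrightarrow> u (n + k) = 0 \<Longrightarrow> f n = 0"
  shows "f summable_on UNIV"
proof (rule finite_nonzero_values_imp_summable_on, rule finite_subset)
  show "{n \<in> UNIV. f n \<noteq> 0} \<subseteq> {n. u n \<noteq> 0} \<union> {n. u (n + k) \<noteq> 0}"
    using assms(2) by auto
qed (use assms(1) finite_support_shift in auto)

text \<open>Pointwise, |a - b|^2 + |a|^2 = 2 Re (cnj a (a - b)) + |b|^2 with a = u(n) and b = u(n +
  k). After summation the two masses cancel by translation invariance.\<close>

lemma increment_norm_eq:
  fixes u :: "'a :: ab_group_add \<Rightarrow> complex"
  assumes fin: "finite {n. u n \<noteq> 0}"
  shows "(\<Sum>\<^sub>\<infinity>n. (cmod (u n - u (n + k)))\<^sup>2) = 2 * (\<Sum>\<^sub>\<infinity>n. Re (cnj (u n) * (u n - u (n + k))))"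
proof -
  let ?f = "\<lambda>n. (cmod (u n - u (n + k)))\<^sup>2" and ?g = "\<lambda>n. Re (cnj (u n) * (u n - u (n + k)))"
  have eq: "?f n + (cmod (u n))\<^sup>2 = 2 * ?g n + (cmod (u (n + k)))\<^sup>2" for n
    by (simp add: cmod_power2) (simp add: power2_eq_square algebra_simps)
  have s: "?f summable_on UNIV" "(\<lambda>n. 2 * ?g n) summable_on UNIV" "(\<lambda>n. (cmod (u n))\<^sup>2) summable_on UNIV"
    "(\<lambda>n. (cmod (u (n + k)))\<^sup>2) summable_on UNIV"
    by (rule summable_on_finite_support2[OF fin, of k]; simp)+
  have "infsum ?f UNIV + (\<Sum>\<^sub>\<infinity>n. (cmod (u n))\<^sup>2) = (\<Sum>\<^sub>\<infinity>n. 2 * ?g n) + (\<Sum>\<^sub>\<infinity>n. (cmod (u (n + k)))\<^sup>2)"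
    by (simp only: infsum_add[OF s(1,3), symmetric] infsum_add[OF s(2,4), symmetric] eq)
  then show ?thesis
    using infsum_shift[of "\<lambda>n. (cmod (u n))\<^sup>2" k] infsum_cmult_right'[of 2 ?g UNIV] by linarith
qed

section \<open>Kinetic energy and translations\<close>

text \<open>The form <u, -Delta u> is summed over the whole lattice. If \<open>u\<close> is
  supported in a box, the factor \<open>cnj (u n)\<close> removes all sites outside it, so this is
  also the form of the restricted operator, while translates of \<open>u\<close> may leave the box
  freely.\<close>

definition kinetic_energy :: "(int ^ 'd \<Rightarrow> complex) \<Rightarrow> real" where
  "kinetic_energy u = (\<Sum>\<^sub>\<infinity>n. Re (cnj (u n) * neg_laplacian u n))"

lemma neg_laplacian_eq: "neg_laplacian u n = (\<Sum>k | l1_norm k = 1. u n - u (n + k))"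
proof -
  have "(\<Sum>m | l1_norm (m - n) = 1. u m - u n) = (\<Sum>k | l1_norm k = 1. u (n + k) - u n)"
    by (rule sum.reindex_bij_witness[of _ "\<lambda>k. n + k" "\<lambda>m. m - n"]) auto
  then show ?thesis unfolding neg_laplacian_def by (simp flip: sum_negf)
qed

text \<open>The factor 2 arises because each undirected edge of the lattice is counted once for
  \<open>k\<close> and once for \<open>-k\<close>.\<close>

lemma kinetic_energy_eq:
  fixes u :: "int ^ 'd \<Rightarrow> complex"
  assumes fin: "finite {n. u n \<noteq> 0}"
  shows "2 * kinetic_energy u = (\<Sum>k | l1_norm k = 1. \<Sum>\<^sub>\<infinity>n. (cmod (u n - u (n + k)))\<^sup>2)"
proof -
  have "kinetic_energy u = (\<Sum>\<^sub>\<infinity>n. \<Sum>k | l1_norm k = 1. Re (cnj (u n) * (u n - u (n + k))))"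
    unfolding kinetic_energy_def neg_laplacian_eq sum_distrib_left Re_sum ..
  also have "\<dots> = (\<Sum>k | l1_norm k = 1. \<Sum>\<^sub>\<infinity>n. Re (cnj (u n) * (u n - u (n + k))))"
    by (rule infsum_sum) (rule summable_on_finite_support[OF fin], simp)
  finally show ?thesis by (simp add: increment_norm_eq[OF fin] sum_distrib_left)
qed

lemma increment_norm_le_kinetic_energy:
  fixes u :: "int ^ 'd \<Rightarrow> complex"
  assumes fin: "finite {n. u n \<noteq> 0}" and k: "l1_norm k = 1"
  shows "(\<Sum>\<^sub>\<infinity>n. (cmod (u n - u (n + k)))\<^sup>2) \<le> 2 * kinetic_energy u"
  unfolding kinetic_energy_eq[OF fin]
  by (rule member_le_sum[where f = "\<lambda>k. \<Sum>\<^sub>\<infinity>n. (cmod (u n - u (n + k)))\<^sup>2"])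
     (use k finite_l1_sphere[of 1] in \<open>auto intro: infsum_nonneg\<close>)

lemma kinetic_energy_nonneg:
  fixes u :: "int ^ 'd \<Rightarrow> complex"
  assumes fin: "finite {n. u n \<noteq> 0}"
  shows "0 \<le> kinetic_energy u"
proof -
  have "0 \<le> 2 * kinetic_energy u"
    unfolding kinetic_energy_eq[OF fin] by (intro sum_nonneg infsum_nonneg) simp
  then show ?thesis by simp
qed

text \<open>In terms of l2 norms this is the triangle inequality along a walk of \<open>j\<close>
  unit steps. It is proved directly for squared norms, by induction on \<open>j\<close>, with
  weights that keep the growth exactly quadratic.\<close>

lemma increment_norm_le:
  fixes u :: "int ^ 'd \<Rightarrow> complex"
  assumes fin: "finite {n. u n \<noteq> 0}"
  shows "l1_norm v = int j \<Longrightarrow>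
    (\<Sum>\<^sub>\<infinity>n. (cmod (u n - u (n + v)))\<^sup>2) \<le> (real j)\<^sup>2 * (2 * kinetic_energy u)"
proof (induction j arbitrary: v)
  case 0
  then show ?case by (simp add: l1_norm_eq_0_iff)
next
  case (Suc j)
  obtain k where k: "l1_norm k = 1" "l1_norm (v - k) = int j"
    using l1_norm_step[OF Suc.prems] .
  define w where "w = v - k"
  have v: "v = w + k" by (simp add: w_def)
  let ?f = "\<lambda>n. (cmod (u n - u (n + w)))\<^sup>2" and ?g = "\<lambda>n. (cmod (u n - u (n + k)))\<^sup>2"
  show ?case
  \<comment> \<open>The weight 1/j below requires j > 0; for j = 0 the walk is the single step
    \<open>k\<close>.\<close>
  proof (cases "j = 0")
    case True
    then have "v = k" using k by (simp add: l1_norm_eq_0_iff)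
    then show ?thesis using increment_norm_le_kinetic_energy[OF fin k(1)] True by simp
  next
    case False
    \<comment> \<open>The weights are chosen such that $(1 + 1/j) j^2 + (1 + j) = (j + 1)^2$.\<close>
    have *: "(cmod (u n - u (n + v)))\<^sup>2 \<le> (1 + 1 / j) * ?f n + (1 + j) * ?g (n + w)" for n
    proof -
      let ?a = "cmod (u n - u (n + w))" and ?b = "cmod (u (n + w) - u (n + v))"
      have "cmod (u n - u (n + v)) \<le> ?a + ?b"
        using norm_triangle_ineq[of "u n - u (n + w)" "u (n + w) - u (n + v)"] by simp
      then have "(cmod (u n - u (n + v)))\<^sup>2 \<le> (?a + ?b)\<^sup>2" by (simp add: power_mono)
      also have "\<dots> \<le> (1 + 1 / j) * ?a\<^sup>2 + (1 + j) * ?b\<^sup>2"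
      proof -
        have "0 \<le> (?a / sqrt j - sqrt j * ?b)\<^sup>2" by simp
        also have "\<dots> = ?a\<^sup>2 / j + j * ?b\<^sup>2 - 2 * ?a * ?b"
          using False by (simp add: power2_diff power_divide power_mult_distrib)
        finally show ?thesis by (simp add: power2_sum algebra_simps)
      qed
      finally show ?thesis by (simp add: v add.assoc)
    qed
    \<comment> \<open>\<open>?g (n + w)\<close> is an increment of the translate of \<open>u\<close>
      by \<open>w\<close>, so the support of that translate is what counts.\<close>
    note fins = finite_support_shift[OF fin, of w]
    have sf: "?f summable_on UNIV" by (rule summable_on_finite_support2[OF fin, of w]) simp
    have sg: "(\<lambda>n. ?g (n + w)) summable_on UNIV"
      by (rule summable_on_finite_support2[OF fins, of k]) (simp add: add_ac)
    have "(\<Sum>\<^sub>\<infinity>n. (cmod (u n - u (n + v)))\<^sup>2) \<le> (\<Sum>\<^sub>\<infinity>n. (1 + 1 / j) * ?f n + (1 + j) * ?g (n + w))"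
      by (intro infsum_mono * summable_on_add summable_on_cmult_right sf sg)
         (rule summable_on_finite_support2[OF fin, of v], simp)
    also have "\<dots> = (1 + 1 / j) * infsum ?f UNIV + (1 + j) * infsum ?g UNIV"
      using infsum_shift[of ?g w]
      by (simp add: infsum_add summable_on_cmult_right sf sg infsum_cmult_right')
    also have "\<dots> \<le> (1 + 1 / j) * ((real j)\<^sup>2 * (2 * kinetic_energy u)) + (1 + j) * (2 * kinetic_energy u)"
      using Suc.IH[OF k(2)] increment_norm_le_kinetic_energy[OF fin k(1)]
      unfolding w_def by (intro add_mono mult_left_mono) auto
    also have "\<dots> = (real (Suc j))\<^sup>2 * (2 * kinetic_energy u)"
      using False by (simp add: field_simps power2_eq_square)
    finally show ?thesis .
  qed
qed

text \<open>The averaging argument for an abstract set \<open>S\<close> of good sites: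
  \<open>g\<close> counts the translations in \<open>K\<close> that lead from \<open>n\<close> into
  \<open>S\<close>, and \<open>b\<close> bounds the length of the walks, so each translation costs
  at most \<open>b^2\<close> times twice the kinetic energy.\<close>

lemma mass_le_energy:
  fixes u :: "int ^ 'd \<Rightarrow> complex" and K S :: "(int ^ 'd) set" and g b :: real
  assumes fin: "finite {n. u n \<noteq> 0}" and K: "finite K"
    and b: "\<And>k. k \<in> K \<Longrightarrow> l1_norm k \<le> b"
    and g: "\<And>n. u n \<noteq> 0 \<Longrightarrow> g \<le> card {k \<in> K. n + k \<in> S}"
  shows "g * (\<Sum>\<^sub>\<infinity>n. (cmod (u n))\<^sup>2) \<le>
    card K * (4 * b\<^sup>2 * kinetic_energy u + 2 * (\<Sum>\<^sub>\<infinity>n. indicator S n * (cmod (u n))\<^sup>2))"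
proof -
  let ?s = "\<lambda>n. indicator S n * (cmod (u n))\<^sup>2"
  let ?f = "\<lambda>k n. 2 * (cmod (u n - u (n + k)))\<^sup>2 + 2 * ?s (n + k)"
  have sf: "?f k summable_on UNIV" for k
    by (rule summable_on_finite_support2[OF fin, of k]) simp
  have pt: "g * (cmod (u n))\<^sup>2 \<le> (\<Sum>k\<in>K. ?f k n)" for n
  proof (cases "u n = 0")
    case True
    then show ?thesis by (auto intro!: sum_nonneg)
  next
    case False
    have "g * (cmod (u n))\<^sup>2 \<le> (\<Sum>k\<in>{k\<in>K. n + k \<in> S}. (cmod (u n))\<^sup>2)"
      using g[OF False] by (simp add: mult_right_mono)
    also have "\<dots> \<le> (\<Sum>k\<in>{k\<in>K. n + k \<in> S}. ?f k n)"
    proof (rule sum_mono)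
      fix k assume "k \<in> {k\<in>K. n + k \<in> S}"
      let ?a = "cmod (u n - u (n + k))" and ?b = "cmod (u (n + k))"
      have "cmod (u n) \<le> ?a + ?b"
        using norm_triangle_ineq[of "u n - u (n + k)" "u (n + k)"] by simp
      then have "(cmod (u n))\<^sup>2 \<le> (?a + ?b)\<^sup>2" by (simp add: power_mono)
      also have "\<dots> \<le> 2 * ?a\<^sup>2 + 2 * ?b\<^sup>2"
        using sum_squares_bound[of ?a ?b] by (simp add: power2_sum)
      finally show "(cmod (u n))\<^sup>2 \<le> ?f k n" using \<open>k \<in> _\<close> by simp
    qed
    \<comment> \<open>The index set of the sum no longer depends on \<open>n\<close>, so the sums
      over \<open>n\<close> and \<open>k\<close> can be exchanged and translation invariance applies
      for each \<open>k\<close>.\<close>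
    also have "\<dots> \<le> (\<Sum>k\<in>K. ?f k n)" by (rule sum_mono2) (use K in auto)
    finally show ?thesis .
  qed
  have "g * (\<Sum>\<^sub>\<infinity>n. (cmod (u n))\<^sup>2) = (\<Sum>\<^sub>\<infinity>n. g * (cmod (u n))\<^sup>2)"
    by (simp add: infsum_cmult_right')
  also have "\<dots> \<le> (\<Sum>\<^sub>\<infinity>n. \<Sum>k\<in>K. ?f k n)"
    by (intro infsum_mono pt summable_on_sum sf) (rule summable_on_finite_support[OF fin], simp)
  also have "\<dots> = (\<Sum>k\<in>K. infsum (?f k) UNIV)"
    by (rule infsum_sum) (rule sf)
  also have "\<dots> \<le> (\<Sum>k\<in>K. 4 * b\<^sup>2 * kinetic_energy u + 2 * infsum ?s UNIV)"
  proof (rule sum_mono)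
    fix k assume "k \<in> K"
    have s1: "(\<lambda>n. (cmod (u n - u (n + k)))\<^sup>2) summable_on UNIV"
      and s2: "(\<lambda>n. ?s (n + k)) summable_on UNIV"
      by (rule summable_on_finite_support2[OF fin, of k]; simp)+
    have "(real (nat (l1_norm k)))\<^sup>2 \<le> b\<^sup>2"
      using b[OF \<open>k \<in> K\<close>] l1_norm_nonneg[of k] by (intro power_mono) auto
    then have "(real (nat (l1_norm k)))\<^sup>2 * (2 * kinetic_energy u) \<le> b\<^sup>2 * (2 * kinetic_energy u)"
      using kinetic_energy_nonneg[OF fin] by (intro mult_right_mono) auto
    moreover have "(\<Sum>\<^sub>\<infinity>n. (cmod (u n - u (n + k)))\<^sup>2) \<le> (real (nat (l1_norm k)))\<^sup>2 * (2 * kinetic_energy u)"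
      by (rule increment_norm_le[OF fin]) (simp add: l1_norm_nonneg)
    moreover have "infsum (?f k) UNIV = 2 * (\<Sum>\<^sub>\<infinity>n. (cmod (u n - u (n + k)))\<^sup>2) + 2 * infsum ?s UNIV"
      using infsum_shift[of ?s k]
      by (subst infsum_add) (auto intro!: summable_on_cmult_right s1 s2 simp: infsum_cmult_right')
    ultimately show "infsum (?f k) UNIV \<le> 4 * b\<^sup>2 * kinetic_energy u + 2 * infsum ?s UNIV"
      by linarith
  qed
  finally show ?thesis by simp
qed

section \<open>The quadratic form on a finite box\<close>

lemma lattice_box_eq:
  fixes x :: "int ^ 'd"
  shows "lattice_box x L =
    {v. \<forall>i. (\<chi> i. x $ i - int L) $ i \<le> v $ i \<and> v $ i < (\<chi> i. x $ i - int L) $ i + int (2 * L + 1)}"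
proof -
  have "max_norm (v - x) \<le> int L \<longleftrightarrow> (\<forall>i. \<bar>v $ i - x $ i\<bar> \<le> int L)" for v
    unfolding max_norm_def by (subst Max_le_iff) auto
  moreover have "\<bar>a - b\<bar> \<le> int L \<longleftrightarrow> b - int L \<le> a \<and> a < b - int L + int (2 * L + 1)" for a b
    by linarith
  ultimately show ?thesis by (simp add: lattice_box_def)
qed

lemma finite_lattice_box: "finite (lattice_box x L)"
  unfolding lattice_box_eq by (rule finite_vec_box)

lemma card_lattice_box: "card (lattice_box (x :: int ^ 'd) L) = (2 * L + 1) ^ CARD('d)"
  unfolding lattice_box_eq by (rule card_vec_box)

lemma infsum_UNIV_eq_sum:
  assumes "finite A" "\<And>n. n \<notin> A \<Longrightarrow> f n = 0"
  shows "infsum f UNIV = sum f A"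
proof -
  have "infsum f UNIV = infsum f A" by (rule infsum_cong_neutral) (use assms in auto)
  then show ?thesis using assms(1) by simp
qed

lemma ell2_finite_support: "finite A \<Longrightarrow> u \<in> ell2 A \<Longrightarrow> finite {n. u n \<noteq> 0}"
  by (rule finite_subset[of _ A]) (auto simp: ell2_def)

text \<open>\<open>u\<close> vanishes outside the box, so the inner cut-off leaves it unchanged, and
  the outer one equals 1 at every site of the sum.\<close>

lemma anderson_form_eq:
  fixes x :: "int ^ 'd"
  assumes "u \<in> ell2 (lattice_box x L)"
  shows "Re (ell2_inner (lattice_box x L) u (anderson_box D \<omega> x L u)) =
    (\<Sum>n\<in>lattice_box x L. Re (cnj (u n) * neg_laplacian u n) + potential D \<omega> n * (cmod (u n))\<^sup>2)"
proof -
  have u: "(\<lambda>m. indicator (lattice_box x L) m * u m) = u"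
    using assms by (auto simp: ell2_def fun_eq_iff indicator_def split: if_splits)
  have "Re (cnj z * (w + of_real c * z)) = Re (cnj z * w) + c * (cmod z)\<^sup>2" for z w c
    by (simp add: cmod_power2) (simp add: power2_eq_square algebra_simps)
  then show ?thesis
    by (simp add: ell2_inner_def finite_lattice_box anderson_box_def restrict_op_def u anderson_op_def
        cong: sum.cong)
qed

lemma ell2_norm_eq:
  assumes "finite A"
  shows "Re (ell2_inner A u u) = (\<Sum>n\<in>A. (cmod (u n))\<^sup>2)"
  using assms unfolding cmod_power2 by (simp add: ell2_inner_def power2_eq_square)

lemma form_ge_mono:
  assumes "finite A" "form_ge A T c" "c' \<le> c"
  shows "form_ge A T c'"
  unfolding form_ge_def
proof
  fix u assume "u \<in> ell2 A"
  then have "c * Re (ell2_inner A u u) \<le> Re (ell2_inner A u (T u))"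
    using assms(2) by (auto simp: form_ge_def)
  moreover have "c' * Re (ell2_inner A u u) \<le> c * Re (ell2_inner A u u)"
    using assms by (intro mult_right_mono) (auto simp: ell2_norm_eq sum_nonneg)
  ultimately show "c' * Re (ell2_inner A u u) \<le> Re (ell2_inner A u (T u))" by linarith
qed

text \<open>The good sites are those of \<open>D\<close> with coupling at least \<epsilon>. The mass
  on them is at most 1/\<epsilon> times the potential energy, and \<epsilon> \<le> 1 and 1 \<le> b
  bring both energies under the common factor 4 b^2. The sites \<open>n + k\<close> may lie outside
  the box: there \<open>u\<close> is 0 and the increment alone carries the estimate.\<close>

lemma form_ge_anderson_box:
  fixes x :: "int ^ 'd" and K :: "(int ^ 'd) set" and b g \<epsilon> :: real
  assumes \<epsilon>: "0 < \<epsilon>" "\<epsilon> \<le> 1"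
    and nonneg: "\<And>n. n \<in> D \<Longrightarrow> 0 \<le> \<omega> n"
    and K: "finite K" "K \<noteq> {}"
    and b: "1 \<le> b" "\<And>k. k \<in> K \<Longrightarrow> l1_norm k \<le> b"
    and g: "\<And>n. n \<in> lattice_box x L \<Longrightarrow> g \<le> card {k \<in> K. n + k \<in> D \<and> \<epsilon> \<le> \<omega> (n + k)}"
  shows "form_ge (lattice_box x L) (anderson_box D \<omega> x L) (g * \<epsilon> / (4 * card K * b\<^sup>2))"
  unfolding form_ge_def
proof
  fix u assume u: "u \<in> ell2 (lattice_box x L)"
  define S where "S = {n \<in> D. \<epsilon> \<le> \<omega> n}"
  have out: "u n = 0" if "n \<notin> lattice_box x L" for n
    using u that by (auto simp: ell2_def)
  have fin: "finite {n. u n \<noteq> 0}" using ell2_finite_support[OF finite_lattice_box u] .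
  define V where "V = (\<Sum>n\<in>lattice_box x L. potential D \<omega> n * (cmod (u n))\<^sup>2)"
  define W where "W = (\<Sum>\<^sub>\<infinity>n. indicator S n * (cmod (u n))\<^sup>2)"
  have N: "(\<Sum>\<^sub>\<infinity>n. (cmod (u n))\<^sup>2) = Re (ell2_inner (lattice_box x L) u u)"
    by (subst infsum_UNIV_eq_sum[OF finite_lattice_box[of x L]])
       (auto simp: out ell2_norm_eq finite_lattice_box)
  have T: "Re (ell2_inner (lattice_box x L) u (anderson_box D \<omega> x L u)) = kinetic_energy u + V"
    unfolding anderson_form_eq[OF u] V_def kinetic_energy_def sum.distrib
    by (subst infsum_UNIV_eq_sum[OF finite_lattice_box[of x L]]) (auto simp: out)
  have W_eq: "W = (\<Sum>n\<in>lattice_box x L. indicator S n * (cmod (u n))\<^sup>2)"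
    unfolding W_def by (subst infsum_UNIV_eq_sum[OF finite_lattice_box[of x L]]) (auto simp: out)
  \<comment> \<open>The potential is at least \<epsilon> on \<open>S\<close> and nonnegative
    elsewhere.\<close>
  have "\<epsilon> * W \<le> V"
    unfolding V_def W_eq sum_distrib_left mult.assoc[symmetric]
    by (intro sum_mono mult_right_mono)
       (auto simp: S_def potential_def indicator_def nonneg)
  have "0 \<le> W" unfolding W_eq by (intro sum_nonneg) auto
  have E: "0 \<le> kinetic_energy u" by (rule kinetic_energy_nonneg[OF fin])
  have b2: "1 \<le> b\<^sup>2" using b(1) by simp
  have "card K > 0" using K by (simp add: card_gt_0_iff)
  have "g * Re (ell2_inner (lattice_box x L) u u) \<le> card K * (4 * b\<^sup>2 * kinetic_energy u + 2 * W)"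
    unfolding W_def N[symmetric]
    by (rule mass_le_energy[OF fin K(1) b(2)]) (use g out in \<open>force simp: S_def\<close>)+
  then have "\<epsilon> * (g * Re (ell2_inner (lattice_box x L) u u)) \<le>
      \<epsilon> * (card K * (4 * b\<^sup>2 * kinetic_energy u + 2 * W))"
    using \<epsilon>(1) by (intro mult_left_mono) auto
  also have "\<dots> = card K * (4 * b\<^sup>2 * (\<epsilon> * kinetic_energy u) + 2 * (\<epsilon> * W))"
    by (simp add: algebra_simps)
  also have "\<dots> \<le> card K * (4 * b\<^sup>2 * kinetic_energy u + 4 * b\<^sup>2 * V)"
  proof (intro mult_left_mono add_mono)
    show "\<epsilon> * kinetic_energy u \<le> kinetic_energy u" using E \<epsilon> by (simp add: mult_left_le_one_le)
    have "0 \<le> V" using \<open>\<epsilon> * W \<le> V\<close> \<open>0 \<le> W\<close> \<epsilon>(1) by (meson less_imp_le mult_nonneg_nonneg order_trans)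
    then have "1 * V \<le> b\<^sup>2 * V" using b2 by (intro mult_right_mono) auto
    then show "2 * (\<epsilon> * W) \<le> 4 * b\<^sup>2 * V" using \<open>\<epsilon> * W \<le> V\<close> \<open>0 \<le> V\<close> by linarith
  qed (use b2 in auto)
  also have "\<dots> = 4 * card K * b\<^sup>2 * (kinetic_energy u + V)" by (simp add: algebra_simps)
  finally show "g * \<epsilon> / (4 * card K * b\<^sup>2) * Re (ell2_inner (lattice_box x L) u u) \<le>
      Re (ell2_inner (lattice_box x L) u (anderson_box D \<omega> x L u))"
    unfolding T using \<open>card K > 0\<close> b(1) by (simp add: field_simps)
qed

section \<open>Many points of a Delone set in a large cube\<close>

text \<open>The cubes of side \<open>R\<close> based at \<open>n + r j\<close>, with integer r > R
  and j in [0, m)^d, have no lattice point in common, and each holds a point of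
  \<open>D\<close>.\<close>

lemma delone_points:
  fixes n :: "int ^ 'd"
  assumes "delone R D" "0 \<le> R"
  obtains T where "T \<subseteq> D" "finite T" "card T = m ^ CARD('d)"
    "\<And>t i. t \<in> T \<Longrightarrow> 0 \<le> (t - n) $ i \<and> (t - n) $ i < int (m * (nat \<lfloor>R\<rfloor> + 1))"
proof -
  define r where "r = nat \<lfloor>R\<rfloor> + 1"
  \<comment> \<open>For integers, the closed interval [0, R] lies in the half-open [0, r); this
    makes neighbouring cubes disjoint.\<close>
  have r: "real_of_int z \<le> R \<Longrightarrow> z < int r" for z
    using assms(2) by (auto simp: r_def simp flip: le_floor_iff)
  define J where "J = {j :: int ^ 'd. \<forall>i. (0 :: int ^ 'd) $ i \<le> j $ i \<and> j $ i < (0 :: int ^ 'd) $ i + int m}"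
  have "\<exists>t. t \<in> lattice_cube R (n + int r *s j) \<inter> D" for j
    using assms(1) by (auto simp: delone_def)
  then obtain t where t: "t j \<in> lattice_cube R (n + int r *s j)" "t j \<in> D" for j
    by (metis IntE)
  have bounds: "int r * j $ i \<le> (t j - n) $ i \<and> (t j - n) $ i < int r * (j $ i + 1)" for j i
  proof -
    have "n $ i + int r * j $ i \<le> t j $ i"
      and *: "real_of_int (t j $ i) \<le> real_of_int (n $ i + int r * j $ i) + R"
      using t(1)[of j] unfolding lattice_cube_def
      by (simp_all only: mem_Collect_eq atLeastAtMost_iff of_int_le_iff
          vector_add_component vector_smult_component)
    moreover have "t j $ i - (n $ i + int r * j $ i) < int r"
      by (rule r) (use * in simp)
    ultimately show ?thesis by (simp add: algebra_simps)
  qed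
  \<comment> \<open>Division by \<open>r\<close> recovers the cube from the point, whence the chosen
    points are distinct.\<close>
  have div: "(t j - n) $ i div int r = j $ i" for j i
    by (rule int_div_pos_eq[where r = "(t j - n) $ i - int r * j $ i"])
       (use bounds[of j i] in \<open>auto simp: algebra_simps\<close>)
  have inj: "inj_on t J"
    by (rule inj_onI) (metis div vec_eq_iff)
  show ?thesis
  proof
    show "t ` J \<subseteq> D" using t by auto
    show "finite (t ` J)" unfolding J_def by (intro finite_imageI finite_vec_box)
    show "card (t ` J) = m ^ CARD('d)"
      unfolding card_image[OF inj] unfolding J_def by (rule card_vec_box)
    fix s i assume "s \<in> t ` J"
    then obtain j where j: "s = t j" "j \<in> J" by auto
    then have "0 \<le> j $ i" "j $ i + 1 \<le> int m" by (auto simp: J_def zless_imp_add1_zle)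
    then have "int r * 0 \<le> int r * j $ i" "int r * (j $ i + 1) \<le> int r * int m"
      by (intro mult_left_mono; simp)+
    then show "0 \<le> (s - n) $ i \<and> (s - n) $ i < int (m * (nat \<lfloor>R\<rfloor> + 1))"
      using bounds[of j i] unfolding r_def[symmetric] j by (simp add: mult.commute)
  qed
qed

section \<open>Probability of many small couplings\<close>

text \<open>If at least half of \<open>T\<close> is hit, all of some \<open>B\<close> with 2 |B|
  \<ge> |T| is hit. By independence this has probability at most s^(2 |B|) \<le> s^|T|, and there
  are at most 2^|T| such \<open>B\<close>. Bounding single hits by s^2 instead of s absorbs the loss
  of half the exponent.\<close>

lemma (in product_prob_space) prob_half_hit_le:
  assumes T: "finite T" "T \<subseteq> I" and E: "\<And>t. t \<in> T \<Longrightarrow> E t \<in> sets (M t)"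
    and s: "\<And>t. t \<in> T \<Longrightarrow> measure (M t) (E t) \<le> s\<^sup>2" "0 \<le> s" "s \<le> 1"
  defines "H \<equiv> {\<omega> \<in> space (Pi\<^sub>M I M). card T \<le> 2 * card {t \<in> T. \<omega> t \<in> E t}}"
  shows "H \<in> sets (Pi\<^sub>M I M)" "measure (Pi\<^sub>M I M) H \<le> (2 * s) ^ card T"
proof -
  define \<B> where "\<B> = {B \<in> Pow T. card T \<le> 2 * card B}"
  define C where "C B = {\<omega> \<in> space (Pi\<^sub>M I M). \<forall>t\<in>B. \<omega> t \<in> E t}" for B
  have fin: "finite \<B>" using T by (simp add: \<B>_def)
  have H: "H = (\<Union>B\<in>\<B>. C B)"
  proof (intro equalityI subsetI)
    fix \<omega> assume "\<omega> \<in> H"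
    then show "\<omega> \<in> (\<Union>B\<in>\<B>. C B)"
      by (intro UN_I[of "{t \<in> T. \<omega> t \<in> E t}"]) (auto simp: H_def \<B>_def C_def)
  next
    fix \<omega> assume "\<omega> \<in> (\<Union>B\<in>\<B>. C B)"
    then obtain B where B: "B \<subseteq> T" "card T \<le> 2 * card B" "\<omega> \<in> C B" by (auto simp: \<B>_def)
    then have "card B \<le> card {t \<in> T. \<omega> t \<in> E t}"
      using T by (intro card_mono) (auto simp: C_def)
    then show "\<omega> \<in> H" using B by (auto simp: H_def C_def)
  qed
  have C: "C B \<in> sets (Pi\<^sub>M I M)" if "B \<in> \<B>" for B
  proof -
    have "B \<subseteq> T" "finite B" using that T finite_subset by (auto simp: \<B>_def)
    then show ?thesis
      unfolding C_def using T E
      by (intro sets.sets_Collect_finite_All sets_Collect_single') (auto simp: Collect_conj_eq)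
  qed
  show "H \<in> sets (Pi\<^sub>M I M)" unfolding H using fin C by (rule sets.finite_UN)
  have "measure (Pi\<^sub>M I M) (C B) \<le> s ^ card T" if "B \<in> \<B>" for B
  proof -
    have B: "B \<subseteq> T" "finite B" "card T \<le> 2 * card B" using that T finite_subset by (auto simp: \<B>_def)
    have "measure (Pi\<^sub>M I M) (C B) = (\<Prod>t\<in>B. measure (M t) (E t))"
    proof -
      have "emeasure (Pi\<^sub>M I M) (C B) = (\<Prod>t\<in>B. emeasure (M t) (E t))"
        unfolding C_def by (rule emeasure_PiM_Collect) (use B T E in auto)
      then show ?thesis
        by (simp add: emeasure_eq_measure M.emeasure_eq_measure prod_ennreal measure_nonneg prod_nonneg)
    qed
    also have "\<dots> \<le> (\<Prod>t\<in>B. s\<^sup>2)" using B s by (intro prod_mono) auto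
    also have "\<dots> = s ^ (2 * card B)" by (simp add: power_mult)
    also have "\<dots> \<le> s ^ card T" using B s by (intro power_decreasing) auto
    finally show ?thesis .
  qed
  then have "measure (Pi\<^sub>M I M) H \<le> (\<Sum>B\<in>\<B>. s ^ card T)"
    unfolding H using C fin by (intro order_trans[OF finite_measure_subadditive_finite] sum_mono) auto
  also have "\<dots> = card \<B> * s ^ card T" by simp
  also have "\<dots> \<le> card (Pow T) * s ^ card T"
    using T s by (intro mult_right_mono of_nat_mono card_mono) (auto simp: \<B>_def)
  also have "\<dots> = (2 * s) ^ card T" using T by (simp add: card_Pow power_mult_distrib)
  finally show "measure (Pi\<^sub>M I M) H \<le> (2 * s) ^ card T" .
qed

section \<open>Measurability of the form bound\<close>

text \<open>Reduces the quantifier over all test functions in \<open>form_ge\<close> to a countable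
  one. Pointwise limits suffice because the form on a finite box involves finitely many
  values.\<close>

lemma finite_support_dense:
  assumes A: "finite A"
  obtains Q :: "('a \<Rightarrow> complex) set" where "countable Q" "\<forall>v\<in>Q. \<forall>n. n \<notin> A \<longrightarrow> v n = 0"
    "\<forall>u. (\<forall>n. n \<notin> A \<longrightarrow> u n = 0) \<longrightarrow> (\<exists>v. (\<forall>j. v j \<in> Q) \<and> (\<forall>n. (\<lambda>j. v j n) \<longlonglongrightarrow> u n))"
proof -
  obtain C :: "complex set" where C: "countable C" "\<And>X. open X \<Longrightarrow> X \<noteq> {} \<Longrightarrow> \<exists>d\<in>C. d \<in> X"
    using countable_dense_setE by metis
  have "closure C = UNIV"
    using C(2)[of "- closure C"] closure_subset[of C] by auto
  then have "\<forall>z. \<exists>s. (\<forall>j. s j \<in> C) \<and> s \<longlonglongrightarrow> z"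
    by (metis closure_sequential UNIV_I)
  then obtain s where s: "s z j \<in> C" "s z \<longlonglongrightarrow> z" for z j by metis
  \<comment> \<open>Elements of \<open>PiE\<close> are \<open>undefined\<close> outside
    \<open>A\<close>; resetting them to 0 makes them vectors supported in \<open>A\<close>.\<close>
  define Q where "Q = (\<lambda>f n. if n \<in> A then f n else 0) ` PiE A (\<lambda>_. C)"
  show ?thesis
  proof
    show "countable Q" unfolding Q_def using A C by (intro countable_image countable_PiE)
    show "\<forall>v\<in>Q. \<forall>n. n \<notin> A \<longrightarrow> v n = 0" by (auto simp: Q_def)
  next
    show "\<forall>u. (\<forall>n. n \<notin> A \<longrightarrow> u n = 0) \<longrightarrow> (\<exists>v. (\<forall>j. v j \<in> Q) \<and> (\<forall>n. (\<lambda>j. v j n) \<longlonglongrightarrow> u n))"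
    proof (intro allI impI)
      fix u :: "'a \<Rightarrow> complex" assume u: "\<forall>n. n \<notin> A \<longrightarrow> u n = 0"
      define v where "v j n = (if n \<in> A then s (u n) j else 0)" for j n
      have "v j \<in> Q" for j
        unfolding Q_def by (rule image_eqI[of _ _ "restrict (\<lambda>n. s (u n) j) A"]) (auto simp: v_def s)
      moreover have "(\<lambda>j. v j n) \<longlonglongrightarrow> u n" for n
        by (cases "n \<in> A") (simp_all add: v_def s u)
      ultimately show "\<exists>v. (\<forall>j. v j \<in> Q) \<and> (\<forall>n. (\<lambda>j. v j n) \<longlonglongrightarrow> u n)" by blast
    qed
  qed
qed

lemma tendsto_neg_laplacian:
  assumes "\<And>n. (\<lambda>j. v j n) \<longlonglongrightarrow> u n"
  shows "(\<lambda>j. neg_laplacian (v j) n) \<longlonglongrightarrow> neg_laplacian u n"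
  unfolding neg_laplacian_def by (intro tendsto_intros assms)

text \<open>For fixed \<omega> the difference \<open>F\<close> of the two forms is continuous in
  \<open>u\<close>, so its sign need only be tested on \<open>Q\<close>; for fixed \<open>u\<close>
  it is a measurable function of finitely many couplings.\<close>

lemma form_ge_measurable:
  fixes x :: "int ^ 'd"
  assumes \<mu>: "sets \<mu> = sets borel"
  shows "{\<omega> \<in> space (coupling_law \<mu> M D). form_ge (lattice_box x L) (anderson_box D \<omega> x L) c}
    \<in> sets (coupling_law \<mu> M D)"
proof -
  let ?A = "lattice_box x L"
  obtain Q :: "(int ^ 'd \<Rightarrow> complex) set" where Q: "countable Q" "\<forall>v\<in>Q. \<forall>n. n \<notin> ?A \<longrightarrow> v n = 0"
    "\<forall>u. (\<forall>n. n \<notin> ?A \<longrightarrow> u n = 0) \<longrightarrow> (\<exists>v. (\<forall>j. v j \<in> Q) \<and> (\<forall>n. (\<lambda>j. v j n) \<longlonglongrightarrow> u n))"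
    by (rule finite_support_dense[OF finite_lattice_box[of x L]])
  define F where "F \<omega> u = (\<Sum>n\<in>?A. Re (cnj (u n) * neg_laplacian u n) + potential D \<omega> n * (cmod (u n))\<^sup>2)
      - c * (\<Sum>n\<in>?A. (cmod (u n))\<^sup>2)" for \<omega> u
  have Q_ell2: "u \<in> ell2 ?A" if "u \<in> Q" for u
    using Q(2) that by (simp add: ell2_def finite_lattice_box)
  have ge_iff: "c * Re (ell2_inner ?A u u) \<le> Re (ell2_inner ?A u (anderson_box D \<omega> x L u)) \<longleftrightarrow> 0 \<le> F \<omega> u"
    if "u \<in> ell2 ?A" for u \<omega>
    by (simp add: anderson_form_eq[OF that] ell2_norm_eq finite_lattice_box F_def)
  have "form_ge ?A (anderson_box D \<omega> x L) c \<longleftrightarrow> (\<forall>u\<in>Q. 0 \<le> F \<omega> u)" for \<omega>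
  proof
    assume *: "\<forall>u\<in>Q. 0 \<le> F \<omega> u"
    have "0 \<le> F \<omega> u" if u: "u \<in> ell2 ?A" for u
    proof -
      obtain v where v: "\<And>j. v j \<in> Q" "\<And>n. (\<lambda>j. v j n) \<longlonglongrightarrow> u n"
        using Q(3)[rule_format, of u] u unfolding ell2_def by blast
      have "(\<lambda>j. F \<omega> (v j)) \<longlonglongrightarrow> F \<omega> u"
        unfolding F_def by (intro tendsto_intros v tendsto_neg_laplacian)
      then show ?thesis by (rule LIMSEQ_le_const) (use v * in auto)
    qed
    then show "form_ge ?A (anderson_box D \<omega> x L) c" by (simp add: form_ge_def ge_iff)
  qed (use Q_ell2 ge_iff in \<open>auto simp: form_ge_def\<close>)
  moreover have "(\<lambda>\<omega>. F \<omega> u) \<in> borel_measurable (coupling_law \<mu> M D)" for u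
  proof -
    have "(\<lambda>\<omega>. potential D \<omega> n) \<in> borel_measurable (coupling_law \<mu> M D)" for n
    proof (cases "n \<in> D")
      case True
      have "(\<lambda>z. z) \<in> borel_measurable (restrict_space \<mu> {0..M})"
        by (rule measurable_restrict_space1) (simp add: measurable_def \<mu> sets_eq_imp_space_eq[OF \<mu>])
      then have "(\<lambda>\<omega>. \<omega> n) \<in> borel_measurable (coupling_law \<mu> M D)"
        unfolding coupling_law_def
        by (rule measurable_compose[OF measurable_component_singleton[OF True]])
      then show ?thesis using True by (simp add: potential_def)
    qed (simp add: potential_def)
    then show ?thesis unfolding F_def by measurable
  qed
  ultimately show ?thesis
    by (simp, intro sets.sets_Collect_countable_All'[OF _ Q(1)]) measurable
qed

section \<open>The single-site distribution\<close>

text \<open>The complement of the support is the union of all open null sets; by the Lindelof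
  property countably many of them cover it.\<close>

lemma emeasure_Compl_msupport:
  assumes "sets \<mu> = sets borel"
  shows "emeasure \<mu> (- msupport \<mu>) = 0"
proof -
  define \<U> where "\<U> = {U :: real set. open U \<and> emeasure \<mu> U = 0}"
  obtain \<V> where \<V>: "\<V> \<subseteq> \<U>" "countable \<V>" "\<Union>\<V> = \<Union>\<U>"
    using Lindelof[of \<U>] by (auto simp: \<U>_def)
  have "- msupport \<mu> = \<Union>\<U>" by (auto simp: msupport_def \<U>_def not_gr_zero)
  also have "\<dots> = (\<Union>U\<in>\<V>. U)" using \<V> by auto
  finally have "- msupport \<mu> = (\<Union>U\<in>\<V>. U)" .
  moreover have "(\<Union>U\<in>\<V>. U) \<in> null_sets \<mu>"
    using \<V>(1) assms by (intro null_sets_UN' \<V>(2)) (auto simp: \<U>_def null_sets_def)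
  ultimately show ?thesis by auto
qed

text \<open>Makes the factors of \<open>coupling_law\<close> probability measures: no mass of \<mu>
  is lost outside [0, M].\<close>

lemma prob_space_restrict_msupport:
  assumes \<mu>: "prob_space \<mu>" "sets \<mu> = sets borel" and supp: "msupport \<mu> \<subseteq> {0..M}"
  shows "prob_space (restrict_space \<mu> {0..M})"
proof -
  interpret prob_space \<mu> by (rule \<mu>(1))
  have S: "space \<mu> = UNIV" using sets_eq_imp_space_eq[OF \<mu>(2)] by simp
  have "open (- msupport \<mu>)"
    unfolding open_subopen[of "- msupport \<mu>"] by (auto simp: msupport_def)
  then have "emeasure \<mu> (- {0..M}) \<le> emeasure \<mu> (- msupport \<mu>)"
    using supp \<mu>(2) by (intro emeasure_mono) auto
  then have "emeasure \<mu> (- {0..M}) = 0" by (simp add: emeasure_Compl_msupport[OF \<mu>(2)])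
  then have "prob {0..M} = 1"
    using prob_compl[of "{0..M}"] \<mu>(2) by (simp add: S Compl_eq_Diff_UNIV emeasure_eq_measure)
  then show ?thesis
    using \<mu>(2) by (intro prob_space_restrict_space) (auto simp: emeasure_eq_measure)
qed

lemma regular_distribution_small_values:
  assumes \<mu>: "regular_distribution \<mu>" and "0 < q"
  obtains \<epsilon> where "0 < \<epsilon>" "\<epsilon> \<le> 1" "measure \<mu> {0..\<epsilon>} \<le> q"
proof -
  obtain f B where f: "f \<in> borel_measurable borel" "\<And>x. 0 \<le> f x" "\<And>x. f x \<le> B"
    and \<mu>_eq: "\<mu> = density lborel (\<lambda>x. ennreal (f x))"
    using \<mu> by (auto simp: regular_distribution_def)
  have B: "0 \<le> B" using f(2)[of 0] f(3)[of 0] by linarith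
  \<comment> \<open>The bounded density gives mass at most B \<epsilon> to [0, \<epsilon>]. Dividing
    by \<open>B + 1\<close> avoids a division by 0.\<close>
  define \<epsilon> where "\<epsilon> = min 1 (q / (B + 1))"
  have \<epsilon>: "0 < \<epsilon>" "\<epsilon> \<le> 1" "\<epsilon> \<le> q / (B + 1)" using B \<open>0 < q\<close> by (auto simp: \<epsilon>_def)
  have "emeasure \<mu> {0..\<epsilon>} = (\<integral>\<^sup>+x. ennreal (f x) * indicator {0..\<epsilon>} x \<partial>lborel)"
    unfolding \<mu>_eq by (rule emeasure_density) (use f in auto)
  also have "\<dots> \<le> (\<integral>\<^sup>+x. ennreal B * indicator {0..\<epsilon>} x \<partial>lborel)"
    by (intro nn_integral_mono mult_right_mono ennreal_leI f) auto
  also have "\<dots> = ennreal (B * \<epsilon>)"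
    using \<epsilon> B by (simp add: nn_integral_cmult_indicator ennreal_mult)
  finally have "measure \<mu> {0..\<epsilon>} \<le> B * \<epsilon>"
    using B \<epsilon> by (simp add: measure_def enn2real_leI)
  also have "\<dots> \<le> (B + 1) * (q / (B + 1))" using B \<epsilon> by (intro mult_mono) auto
  also have "\<dots> = q" using B by simp
  finally show ?thesis using \<epsilon> that by blast
qed

section \<open>The probability estimate and the choice of scales\<close>

text \<open>The deterministic bound is applied with |K| = (m r)^d, b = d m r and g = m^d / 2, which
  yields the displayed constant. The factor (2 L + 1)^d is the number of sites in the union
  bound.\<close>

lemma prob_form_ge_anderson_box:
  fixes x :: "int ^ 'd" and s \<epsilon> :: real
  assumes \<mu>: "prob_space \<mu>" "sets \<mu> = sets borel" "msupport \<mu> \<subseteq> {0..M}"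
    and s: "measure \<mu> {0..\<epsilon>} \<le> s\<^sup>2" "0 \<le> s" "s \<le> 1"
    and \<epsilon>: "0 < \<epsilon>" "\<epsilon> \<le> 1" and D: "delone R D" "1 \<le> R" and m: "1 \<le> m"
  defines "r \<equiv> nat \<lfloor>R\<rfloor> + 1"
  shows "1 - (2 * real L + 1) ^ CARD('d) * (2 * s) ^ (m ^ CARD('d)) \<le>
    measure (coupling_law \<mu> M D) {\<omega> \<in> space (coupling_law \<mu> M D).
      form_ge (lattice_box x L) (anderson_box D \<omega> x L)
        (\<epsilon> / (8 * (real CARD('d))\<^sup>2 * (real m)\<^sup>2 * real r ^ (CARD('d) + 2)))}"
proof -
  let ?d = "CARD('d)"
  define \<mu>' where "\<mu>' = restrict_space \<mu> {0..M}"
  have \<mu>': "prob_space \<mu>'" unfolding \<mu>'_def by (rule prob_space_restrict_msupport[OF \<mu>])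
  then interpret sf: prob_space \<mu>' .
  interpret P: product_prob_space "\<lambda>_. \<mu>'" D
    by unfold_locales
  have S: "space \<mu> = UNIV" using sets_eq_imp_space_eq[OF \<mu>(2)] by simp
  have space': "space \<mu>' = {0..M}" by (simp add: \<mu>'_def space_restrict_space S)
  define P where "P = coupling_law \<mu> M D"
  have P_eq: "P = Pi\<^sub>M D (\<lambda>_. \<mu>')" by (simp add: P_def coupling_law_def \<mu>'_def)
  \<comment> \<open>The cut with \<open>{0..M}\<close> places the event in the space of the
    restricted law; the strict bound makes its complement there exactly the couplings of at least
    \<epsilon>.\<close>
  define E where "E = {z \<in> {0..M}. z < \<epsilon>}"
  have E: "E \<in> sets \<mu>'" unfolding \<mu>'_def sets_restrict_space
    by (rule image_eqI[of _ _ "{..<\<epsilon>}"]) (auto simp: E_def \<mu>(2))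
  have "measure \<mu>' E = measure \<mu> E"
    unfolding \<mu>'_def by (rule measure_restrict_space) (auto simp: E_def \<mu>(2))
  also have "\<dots> \<le> measure \<mu> {0..\<epsilon>}"
  proof -
    interpret prob_space \<mu> by (rule \<mu>)
    show ?thesis by (rule finite_measure_mono) (auto simp: E_def \<mu>(2))
  qed
  finally have E_le: "measure \<mu>' E \<le> s\<^sup>2" using s by linarith
  define K where "K = {v :: int ^ 'd. \<forall>i. (0 :: int ^ 'd) $ i \<le> v $ i \<and> v $ i < (0 :: int ^ 'd) $ i + int (m * r)}"
  have K: "finite K" "card K = (m * r) ^ ?d"
    unfolding K_def by (rule finite_vec_box card_vec_box)+
  have "0 \<in> K" using m by (simp add: K_def r_def del: of_nat_Suc of_nat_mult)
  have l1: "l1_norm k \<le> real (?d * (m * r))" if "k \<in> K" for k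
  proof -
    have "l1_norm k \<le> (\<Sum>i\<in>(UNIV :: 'd set). int (m * r))"
      unfolding l1_norm_def using that by (intro sum_mono) (auto simp: K_def less_imp_le)
    then have "l1_norm k \<le> int (?d * (m * r))" by simp
    then show ?thesis by (metis of_int_le_iff of_int_of_nat_eq)
  qed
  have "\<exists>T\<subseteq>D. finite T \<and> card T = m ^ ?d \<and> (\<forall>t\<in>T. t - n \<in> K)" for n
  proof -
    have "0 \<le> R" using D(2) by simp
    obtain T where "T \<subseteq> D" "finite T" "card T = m ^ ?d"
      "\<And>t i. t \<in> T \<Longrightarrow> 0 \<le> (t - n) $ i \<and> (t - n) $ i < int (m * (nat \<lfloor>R\<rfloor> + 1))"
      using delone_points[OF D(1) \<open>0 \<le> R\<close>, of m n] by metis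
    then show ?thesis by (intro exI[of _ T]) (simp add: K_def r_def)
  qed
  then obtain T where T: "\<And>n. T n \<subseteq> D" "\<And>n. finite (T n)" "\<And>n. card (T n) = m ^ ?d"
    "\<And>n t. t \<in> T n \<Longrightarrow> t - n \<in> K"
    by metis
  define H where "H n = {\<omega> \<in> space P. card (T n) \<le> 2 * card {t \<in> T n. \<omega> t \<in> E}}" for n
  have H: "H n \<in> sets P" "measure P (H n) \<le> (2 * s) ^ (m ^ ?d)" for n
    using P.prob_half_hit_le[of "T n" "\<lambda>_. E" s] T(1-3) E E_le s
    by (auto simp: H_def P_eq)
  let ?A = "lattice_box x L"
  let ?c = "\<epsilon> / (8 * (real ?d)\<^sup>2 * (real m)\<^sup>2 * real r ^ (?d + 2))"
  define G where "G = {\<omega> \<in> space P. form_ge ?A (anderson_box D \<omega> x L) ?c}"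
  have G: "G \<in> sets P" unfolding G_def P_def by (rule form_ge_measurable[OF \<mu>(2)])
  have "space P - G \<subseteq> (\<Union>n\<in>?A. H n)"
  proof (rule ccontr)
    assume "\<not> ?thesis"
    then obtain \<omega> where \<omega>: "\<omega> \<in> space P" "\<omega> \<notin> G" "\<And>n. n \<in> ?A \<Longrightarrow> \<omega> \<notin> H n" by auto
    have range: "\<omega> n \<in> {0..M}" if "n \<in> D" for n
      using \<omega>(1) that by (auto simp: P_eq space_PiM space' PiE_iff)
    \<comment> \<open>Outside \<open>H n\<close> fewer than half of the couplings on
      \<open>T n\<close> lie in \<open>E\<close>; the remaining points, shifted by
      \<open>-n\<close>, are good translations.\<close>
    have count: "real (m ^ ?d) / 2 \<le> card {k \<in> K. n + k \<in> D \<and> \<epsilon> \<le> \<omega> (n + k)}" if "n \<in> ?A" for n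
    proof -
      have "card (T n) = card {t \<in> T n. \<omega> t \<in> E} + card {t \<in> T n. \<omega> t \<notin> E}"
        using T(2)[of n] by (subst card_Un_disjoint[symmetric]) (auto intro!: arg_cong[where f = card])
      moreover have "card {t \<in> T n. \<omega> t \<notin> E} \<le> card {k \<in> K. n + k \<in> D \<and> \<epsilon> \<le> \<omega> (n + k)}"
      proof (rule card_inj_on_le[of "\<lambda>t. t - n"])
        show "(\<lambda>t. t - n) ` {t \<in> T n. \<omega> t \<notin> E} \<subseteq> {k \<in> K. n + k \<in> D \<and> \<epsilon> \<le> \<omega> (n + k)}"
        proof (rule image_subsetI)
          fix t assume t: "t \<in> {t \<in> T n. \<omega> t \<notin> E}"
          then have "t \<in> D" using T(1) by auto
          then show "t - n \<in> {k \<in> K. n + k \<in> D \<and> \<epsilon> \<le> \<omega> (n + k)}"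
            using t T(4)[of t n] range[of t] by (simp add: E_def)
        qed
      qed (use K(1) in \<open>auto simp: inj_on_def\<close>)
      ultimately show ?thesis using \<omega>(1) \<omega>(3)[OF that] T(3)[of n] by (simp add: H_def)
    qed
    have dmr: "1 \<le> real (?d * (m * r))"
      using m by (simp add: r_def flip: of_nat_mult)
    have "form_ge ?A (anderson_box D \<omega> x L)
        (real (m ^ ?d) / 2 * \<epsilon> / (4 * card K * (real (?d * (m * r)))\<^sup>2))"
      by (rule form_ge_anderson_box[OF \<epsilon> _ K(1) _ dmr l1 count])
         (use range \<open>0 \<in> K\<close> in auto)
    also have "real (m ^ ?d) / 2 * \<epsilon> / (4 * card K * (real (?d * (m * r)))\<^sup>2) = ?c"
      using m unfolding K(2) by (simp add: power_mult_distrib power_add power2_eq_square field_simps)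
    finally show False using \<omega> by (simp add: G_def)
  qed
  then have "measure P (space P - G) \<le> measure P (\<Union>n\<in>?A. H n)"
    using H(1) finite_lattice_box unfolding P_eq by (intro P.finite_measure_mono) auto
  also have "\<dots> \<le> (\<Sum>n\<in>?A. measure P (H n))"
    using H(1) finite_lattice_box unfolding P_eq by (intro P.finite_measure_subadditive_finite) auto
  also have "\<dots> \<le> card ?A * (2 * s) ^ (m ^ ?d)" using H(2) by (rule sum_bounded_above)
  also have "\<dots> = (2 * real L + 1) ^ ?d * (2 * s) ^ (m ^ ?d)" by (simp add: card_lattice_box add.commute)
  finally have "1 - (2 * real L + 1) ^ ?d * (2 * s) ^ (m ^ ?d) \<le> measure P G"
    using P.prob_compl[of G] G unfolding P_eq by simp
  then show ?thesis unfolding G_def P_def .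
qed

text \<open>It remains to choose \<open>m\<close> of order (log L)^(1/d), large enough for the
  probability and small enough for the energy. The order of the quantifiers expresses on what
  \<open>Lt\<close> and \<open>C\<close> may depend.\<close>

theorem proposition2p3:
  fixes \<mu> :: "real measure" and p :: real
  assumes "regular_distribution \<mu>" and "p > 0"
  shows "\<exists>Lt :: real \<Rightarrow> nat. \<forall>M>0. msupport \<mu> \<subseteq> {0..M} \<longrightarrow>
    (\<exists>C>0. \<forall>R\<ge>1. \<forall>D :: (int ^ 'd) set. delone R D \<longrightarrow> (\<forall>L\<ge>Lt R.
      (INF x. measure (coupling_law \<mu> M D)
         {\<omega> \<in> space (coupling_law \<mu> M D).
            form_ge (lattice_box x L) (anderson_box D \<omega> x L)
              (C * R powr (- 2 * (real CARD('d) + 2)) * ln (real L) powr (- 2 / real CARD('d)))})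
      \<ge> 1 - real L powr (- p * real CARD('d))))"
proof -
  let ?d = "CARD('d)"
  have "prob_space \<mu>" and sets: "sets \<mu> = sets borel"
    using assms(1) by (auto simp: regular_distribution_def real_distribution_def real_distribution_axioms_def)
  \<comment> \<open>Chosen so that 2 s = exp (-1), which turns the failure probability per site into
    exp (-m^d).\<close>
  define s where "s = exp (- 1) / (2 :: real)"
  have s: "0 < s" "s \<le> 1" using order.trans[of "exp (- 1 :: real)" 1 2] by (simp_all add: s_def)
  obtain \<epsilon> where \<epsilon>: "0 < \<epsilon>" "\<epsilon> \<le> 1" "measure \<mu> {0..\<epsilon>} \<le> s\<^sup>2"
    using regular_distribution_small_values[OF assms(1), of "s\<^sup>2"] s by auto
  \<comment> \<open>Of the decay L^(-a), a factor L^(2 d) pays for the sites of the box and L^(-p d)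
    remains.\<close>
  define a where "a = (p + 2) * real ?d"
  have d: "1 \<le> real ?d" by (simp add: Suc_le_eq)
  have a: "1 \<le> a"
  proof -
    have "1 * 1 \<le> (p + 2) * real ?d" using assms(2) d by (intro mult_mono) auto
    then show ?thesis by (simp add: a_def)
  qed
  \<comment> \<open>Here 32 = 8 * 4, the 4 coming from m \<le> 2 y; 2^(d + 2) comes from r \<le> 2
    R, and a^(2/d) from y^2 = (a log L)^(2/d).\<close>
  define C where "C = \<epsilon> / (32 * (real ?d)\<^sup>2 * 2 ^ (?d + 2) * a powr (2 / ?d))"
  have C: "0 < C" using \<epsilon> a by (simp add: C_def)
  show ?thesis
  \<comment> \<open>The scale 3 works for every \<open>R\<close>: it gives log L \<ge> 1, since e
    \<le> 3, and 2 L + 1 \<le> 3 L \<le> L^2.\<close>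
  proof (rule exI[of _ "\<lambda>_. 3"], intro allI impI exI[of _ C] conjI C)
    fix M R :: real and D :: "(int ^ 'd) set" and L :: nat
    assume supp: "msupport \<mu> \<subseteq> {0..M}" and R: "1 \<le> R" and D: "delone R D" and L: "3 \<le> L"
    have lnL: "1 \<le> ln (real L)"
    proof -
      have "exp 1 \<le> real L" using exp_le L by linarith
      then show ?thesis using L by (simp add: ln_ge_iff)
    qed
    \<comment> \<open>The solution of y^d = a log L. Since y \<ge> 1, rounding up to
      \<open>m\<close> at most doubles it.\<close>
    define y where "y = (a * ln L) powr (1 / ?d)"
    have al: "1 \<le> a * ln L" using mult_mono[OF a lnL] a by simp
    have y: "1 \<le> y" using al by (simp add: y_def ge_one_powr_ge_zero)
    define m where "m = nat \<lceil>y\<rceil>"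
    have m: "y \<le> m" "m \<le> 2 * y" using y by (auto simp: m_def) linarith
    have m1: "1 \<le> m" using m y by linarith
    define r where "r = nat \<lfloor>R\<rfloor> + 1"
    have "0 \<le> \<lfloor>R\<rfloor>" using R by simp
    then have "real r = of_int \<lfloor>R\<rfloor> + 1" by (simp add: r_def)
    then have r: "0 < real r" "r \<le> 2 * R"
      using R \<open>0 \<le> \<lfloor>R\<rfloor>\<close> of_int_floor_le[of R] by linarith+
    show "(INF x. measure (coupling_law \<mu> M D)
         {\<omega> \<in> space (coupling_law \<mu> M D).
            form_ge (lattice_box x L) (anderson_box D \<omega> x L)
              (C * R powr (- 2 * (real ?d + 2)) * ln (real L) powr (- 2 / real ?d))})
      \<ge> 1 - real L powr (- p * real ?d)"
    proof (rule cINF_greatest)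
      fix x :: "int ^ 'd"
      let ?c = "C * R powr (- 2 * (real ?d + 2)) * ln (real L) powr (- 2 / real ?d)"
      let ?c' = "\<epsilon> / (8 * (real ?d)\<^sup>2 * (real m)\<^sup>2 * real r ^ (?d + 2))"
      let ?P = "coupling_law \<mu> M D"
      have c: "?c \<le> ?c'"
      proof -
        have "y\<^sup>2 = (a * ln L) powr (2 / ?d)"
          unfolding y_def by (simp add: powr_powr flip: powr_numeral)
        also have "\<dots> = a powr (2 / ?d) * ln L powr (2 / ?d)"
          using a lnL by (simp add: powr_mult)
        finally have y2: "y\<^sup>2 = a powr (2 / ?d) * ln L powr (2 / ?d)" .
        have "(real m)\<^sup>2 \<le> (2 * y)\<^sup>2" using m by (intro power_mono) auto
        then have "(real m)\<^sup>2 \<le> 4 * (a powr (2 / ?d) * ln L powr (2 / ?d))"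
          by (simp add: power_mult_distrib y2)
        moreover have "real r ^ (?d + 2) \<le> 2 ^ (?d + 2) * R powr (2 * (real ?d + 2))"
        proof -
          have "real r ^ (?d + 2) \<le> (2 * R) ^ (?d + 2)" using r by (intro power_mono) auto
          also have "\<dots> = 2 ^ (?d + 2) * R powr (real (?d + 2))"
            using R by (simp only: power_mult_distrib powr_realpow)
          \<comment> \<open>The argument gives the power R^(-(d + 2)); with R \<ge> 1 it is weakened
            to the stated one.\<close>
          also have "\<dots> \<le> 2 ^ (?d + 2) * R powr (2 * (real ?d + 2))"
            using R by (intro mult_left_mono powr_mono) auto
          finally show ?thesis .
        qed
        ultimately have "8 * (real ?d)\<^sup>2 * (real m)\<^sup>2 * real r ^ (?d + 2) \<le>
            8 * (real ?d)\<^sup>2 * (4 * (a powr (2 / ?d) * ln L powr (2 / ?d))) *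
              (2 ^ (?d + 2) * R powr (2 * (real ?d + 2)))"
          by (intro mult_mono mult_left_mono) auto
        then have "\<epsilon> / (8 * (real ?d)\<^sup>2 * (4 * (a powr (2 / ?d) * ln L powr (2 / ?d))) *
              (2 ^ (?d + 2) * R powr (2 * (real ?d + 2)))) \<le> ?c'"
          using \<epsilon>(1) m1 r(1) by (intro frac_le) auto
        also have "\<epsilon> / (8 * (real ?d)\<^sup>2 * (4 * (a powr (2 / ?d) * ln L powr (2 / ?d))) *
              (2 ^ (?d + 2) * R powr (2 * (real ?d + 2)))) = ?c"
          unfolding C_def mult_minus_left minus_divide_left[symmetric] powr_minus
          by (simp add: field_simps)
        finally show ?thesis .
      qed
      have prob: "(2 * real L + 1) ^ ?d * (2 * s) ^ (m ^ ?d) \<le> real L powr (- p * real ?d)"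
      proof -
        have "a * ln L = y ^ ?d"
          using powr_realpow[of y ?d] y a lnL by (simp add: y_def powr_powr)
        also have "\<dots> \<le> real (m ^ ?d)" using m y by (simp add: power_mono)
        finally have "exp (- real (m ^ ?d)) \<le> real L powr (- a)"
          using L by (simp add: powr_def)
        moreover have "(2 * s) ^ (m ^ ?d) = exp (- real (m ^ ?d))"
          by (simp add: s_def flip: exp_of_nat_mult)
        moreover have "(2 * real L + 1) ^ ?d \<le> real L powr (2 * real ?d)"
        proof -
          have "2 * real L + 1 \<le> 3 * real L" using L by simp
          also have "\<dots> \<le> real L powr 2" using L by (simp add: powr_numeral power2_eq_square)
          finally have "(2 * real L + 1) ^ ?d \<le> (real L powr 2) ^ ?d" by (intro power_mono) auto
          also have "\<dots> = real L powr (2 * real ?d)" using L by (subst powr_power) (simp_all add: mult.commute del: powr_numeral)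
          finally show ?thesis .
        qed
        ultimately have "(2 * real L + 1) ^ ?d * (2 * s) ^ (m ^ ?d) \<le> real L powr (2 * real ?d) * real L powr (- a)"
          by (intro mult_mono) auto
        also have "\<dots> = real L powr (- p * real ?d)"
          by (simp add: a_def algebra_simps flip: powr_add)
        finally show ?thesis .
      qed
      have "1 - real L powr (- p * real ?d) \<le> 1 - (2 * real L + 1) ^ ?d * (2 * s) ^ (m ^ ?d)"
        using prob by simp
      also have "\<dots> \<le> measure ?P {\<omega> \<in> space ?P. form_ge (lattice_box x L) (anderson_box D \<omega> x L) ?c'}"
        unfolding r_def
        using s by (intro prob_form_ge_anderson_box \<open>prob_space \<mu>\<close> sets supp \<epsilon> D R m1) auto
      also have "\<dots> \<le> measure ?P {\<omega> \<in> space ?P. form_ge (lattice_box x L) (anderson_box D \<omega> x L) ?c}"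
      proof -
        interpret prob_space ?P
          unfolding coupling_law_def
          by (intro prob_space_PiM prob_space_restrict_msupport \<open>prob_space \<mu>\<close> sets supp)
        \<comment> \<open>Lowering the constant enlarges the event, and monotonicity of the measure
          needs the larger event to be measurable.\<close>
        show ?thesis
          by (rule finite_measure_mono)
             (use form_ge_measurable[OF sets] form_ge_mono[OF finite_lattice_box _ c] in auto)
      qed
      finally show "1 - real L powr (- p * real ?d) \<le>
        measure ?P {\<omega> \<in> space ?P. form_ge (lattice_box x L) (anderson_box D \<omega> x L) ?c}" .
    qed simp
  qed
qed

end
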